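(* Let $m\ge 2$ and $n\ge 1$. Then $CP_{m,n}$ and $COP_{m,n}$ are dual to each other; that is, in the space of real $m$th order $n$-dimensional symmetric tensors with the inner product $\bullet$, $COP_{m,n}$ is the dual cone of $CP_{m,n}$, and $CP_{m,n}$ is the dual cone of $COP_{m,n}$.
   Context: A real $m$th order $n$-dimensional tensor is an array $\mathcal{A} = (a_{i_1\cdots i_m})$ of real numbers indexed by $1\le i_1,\dots,i_m\le n$; it is symmetric if its entries are invariant under any permutation of the indices. For $u\in\mathbb{R}^n$, $u^m$ denotes the rank-one tensor $(u_{i_1}\cdots u_{i_m})$. $\mathbb{R}^n_+$ is the set of nonnegative vectors in $\mathbb{R}^n$. For a tensor $\mathcal{B}=(b_{i_1\cdots i_m})$ and a vector $x$, $\mathcal{B}x^m=\sum_{i_1,\dots,i_m=1}^n b_{i_1\cdots i_m}x_{i_1}\cdots x_{i_m}$. A tensor $\mathcal{A}$ is completely positive (CP) if there are finitely many vectors $u^{(1)},\dots,u^{(r)}\in\mathbb{R}^n_+$ with $\mathcal{A}=\sum_{k=1}^r (u^{(k)})^m$ (such a tensor is symmetric). A real symmetric tensor $\mathcal{B}$ is copositive if $\mathcal{B}x^m\ge 0$ for all $x\in\mathbb{R}^n_+$. $CP_{m,n}$ and $COP_{m,n}$ denote the sets of all $m$th order $n$-dimensional completely positive tensors and copositive tensors, respectively. The inner product of symmetric tensors $\mathcal{A}=(a_{i_1\cdots i_m})$ and $\mathcal{B}=(b_{i_1\cdots i_m})$ is $\mathcal{A}\bullet\mathcal{B}=\sum_{i_1,\dots,i_m=1}^n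 a_{i_1\cdots i_m}b_{i_1\cdots i_m}$. The dual cone of a set $K$ of symmetric tensors is the set of all real symmetric tensors $\mathcal{B}$ (of the same order and dimension) with $\mathcal{A}\bullet\mathcal{B}\ge 0$ for all $\mathcal{A}\in K$. *)

theory Defs
  imports "HOL-Analysis.Analysis"
begin

text \<open>
  The modes of a tensor are indexed by a finite type \<open>'m\<close> and each mode by a finite type \<open>'n\<close>,
  so the order is \<open>CARD('m)\<close> and the dimension is \<open>CARD('n)\<close>. A multi-index
  \<open>(i\<^sub>1, \<dots>, i\<^sub>m)\<close> is a function \<open>'m \<Rightarrow> 'n\<close>. Since types are nonempty, the dimension
  is always at least 1.
\<close>

type_synonym ('m, 'n) tensor = "(real, 'm \<Rightarrow> 'n) vec"

definition symmetric_tensor :: "('m::finite, 'n::finite) tensor \<Rightarrow> bool" where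
  "symmetric_tensor A \<longleftrightarrow> (\<forall>p. p permutes UNIV \<longrightarrow> (\<forall>i. A $ (i \<circ> p) = A $ i))"

definition nonneg_vecs :: "(real ^ 'n::finite) set" where
  "nonneg_vecs = {x. \<forall>j. 0 \<le> x $ j}"

definition rank_one :: "real ^ 'n \<Rightarrow> ('m::finite, 'n::finite) tensor" where
  "rank_one u = (\<chi> i. \<Prod>k\<in>UNIV. u $ (i k))"

definition tensor_form :: "('m::finite, 'n::finite) tensor \<Rightarrow> real ^ 'n \<Rightarrow> real" where
  "tensor_form B x = (\<Sum>i\<in>UNIV. B $ i * (\<Prod>k\<in>UNIV. x $ (i k)))"

definition CP :: "('m::finite, 'n::finite) tensor set" where
  "CP = {A. \<exists>(r::nat) u. (\<forall>k\<in>{1..r}. u k \<in> nonneg_vecs) \<and> A = (\<Sum>k=1..r. rank_one (u k))}"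

definition COP :: "('m::finite, 'n::finite) tensor set" where
  "COP = {B. symmetric_tensor B \<and> (\<forall>x\<in>nonneg_vecs. 0 \<le> tensor_form B x)}"

text \<open>The entrywise inner product of tensors is the library inner product on \<open>vec\<close>.\<close>

lemma tensor_inner_eq:
  fixes A B :: "('m::finite, 'n::finite) tensor"
  shows "A \<bullet> B = (\<Sum>i\<in>UNIV. A $ i * B $ i)"
  by (simp add: inner_vec_def)

text \<open>The dual cone is taken inside the space of symmetric tensors.\<close>

definition dual_cone :: "('m::finite, 'n::finite) tensor set \<Rightarrow> ('m, 'n) tensor set" where
  "dual_cone K = {B. symmetric_tensor B \<and> (\<forall>A\<in>K. 0 \<le> A \<bullet> B)}"

end

theory Submission
  imports Defs
begin

text \<open>
  Pairing a tensor with a rank-one tensor evaluates its form, \<open>B \<bullet> u\<^sup>m = B u\<^sup>m\<close>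
  (\<open>inner_rank_one\<close>). Since the completely positive tensors are the sums of such \<open>u\<^sup>m\<close> with
  \<open>u\<close> nonnegative, the dual cone of \<open>CP\<close> is \<open>COP\<close>. The other half is then the
  bipolar theorem for \<open>CP\<close>, and the content is that \<open>CP\<close> is closed.

  Closedness comes from a compact base. By homogeneity, \<open>CP\<close> is already generated by the
  tensors \<open>u\<^sup>m\<close> with \<open>u\<close> in the probability simplex. These form a compact set, so their convex hull
  is compact as well. The identity \<open>u\<^sup>m \<bullet> v\<^sup>m = (u \<bullet> v)\<^sup>m\<close> with
  \<open>u = (1, \<dots>, 1)\<close> puts this hull into an affine hyperplane that misses the origin, and the
  cone over a compact convex set avoiding the origin is closed (\<open>closed_CP\<close>).

  The bipolar theorem has to be proved inside the space of symmetric tensors: a functional separating a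
  symmetric tensor from \<open>CP\<close> must itself be given by a symmetric tensor. The metric projection
  supplies one without averaging over permutations: if \<open>P\<close> is the point of the closed
  cone nearest to \<open>A\<close>, then \<open>P - A\<close> separates \<open>A\<close> from the cone, and it is
  symmetric because \<open>P\<close> and \<open>A\<close> are (\<open>dual_cone_dual_cone\<close>).
\<close>

section \<open>Rank-one tensors\<close>

lemma inner_rank_one:
  "B \<bullet> (rank_one x :: ('m::finite, 'n::finite) tensor) = tensor_form B x"
  by (simp add: tensor_inner_eq tensor_form_def rank_one_def)

text \<open>Expanding the \<open>m\<close>th power of the sum \<open>u \<bullet> v\<close> by distributivity gives one
  product for each multi-index.\<close>

lemma rank_one_inner_rank_one:
  "(rank_one u :: ('m::finite, 'n::finite) tensor) \<bullet> rank_one v = (u \<bullet> v) ^ CARD('m)"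
proof -
  have "(rank_one u :: ('m, 'n) tensor) \<bullet> rank_one v
      = (\<Sum>i\<in>(UNIV :: 'm set) \<rightarrow>\<^sub>E (UNIV :: 'n set). \<Prod>k\<in>UNIV. u $ (i k) * v $ (i k))"
    by (simp add: tensor_inner_eq rank_one_def prod.distrib)
  also have "\<dots> = (\<Prod>k\<in>(UNIV :: 'm set). \<Sum>j\<in>UNIV. u $ j * v $ j)"
    by (rule prod_sum_PiE [symmetric]) auto
  finally show ?thesis
    by (simp add: inner_vec_def)
qed

lemma rank_one_scaleR:
  "(rank_one (c *\<^sub>R u) :: ('m::finite, 'n::finite) tensor) = c ^ CARD('m) *\<^sub>R rank_one u"
  by (simp add: rank_one_def vec_eq_iff prod.distrib)

lemma continuous_on_rank_one:
  "continuous_on S (rank_one :: real ^ 'n \<Rightarrow> ('m::finite, 'n::finite) tensor)"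
  unfolding rank_one_def by (intro continuous_intros)

lemma symmetric_tensor_rank_one:
  "symmetric_tensor (rank_one u :: ('m::finite, 'n::finite) tensor)"
proof -
  have "(\<Prod>k\<in>UNIV. u $ (i (p k))) = (\<Prod>k\<in>UNIV. u $ (i k))" if "p permutes UNIV"
    for p :: "'m \<Rightarrow> 'm" and i
    using prod.permute [OF that, of "\<lambda>k. u $ (i k)"] by (simp add: o_def)
  then show ?thesis
    by (simp add: symmetric_tensor_def rank_one_def)
qed

lemma symmetric_tensor_diff:
  "symmetric_tensor A \<Longrightarrow> symmetric_tensor B \<Longrightarrow> symmetric_tensor (A - B)"
  by (simp add: symmetric_tensor_def)

section \<open>The completely positive tensors form a convex cone\<close>

lemma CP_symmetric:
  assumes "A \<in> CP"
  shows "symmetric_tensor A"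
proof -
  obtain r u where A: "A = (\<Sum>k=(1::nat)..r. rank_one (u k))"
    using assms by (auto simp: CP_def)
  show ?thesis
    using symmetric_tensor_rank_one by (auto simp: A symmetric_tensor_def intro!: sum.cong)
qed

lemma CP_zero: "0 \<in> CP"
  by (auto simp: CP_def intro!: exI [of _ 0])

lemma rank_one_in_CP: "u \<in> nonneg_vecs \<Longrightarrow> rank_one u \<in> CP"
  by (auto simp: CP_def intro!: exI [of _ 1] exI [of _ "\<lambda>_. u"])

lemma CP_add:
  fixes A B :: "('m::finite, 'n::finite) tensor"
  assumes "A \<in> CP" "B \<in> CP"
  shows "A + B \<in> CP"
proof -
  obtain r u where u: "\<forall>k\<in>{1..r}. u k \<in> nonneg_vecs" "A = (\<Sum>k=(1::nat)..r. rank_one (u k))"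
    using assms by (auto simp: CP_def)
  obtain s v where v: "\<forall>k\<in>{1..s}. v k \<in> nonneg_vecs" "B = (\<Sum>k=(1::nat)..s. rank_one (v k))"
    using assms by (auto simp: CP_def)
  \<comment> \<open>The two generating families, listed one after the other.\<close>
  define w where "w k = (if k \<le> r then u k else v (k - r))" for k
  have "\<forall>k\<in>{1..r + s}. w k \<in> nonneg_vecs"
  proof
    fix k assume "k \<in> {1..r + s}"
    then have "k \<le> r \<and> k \<in> {1..r} \<or> \<not> k \<le> r \<and> k - r \<in> {1..s}"
      by auto
    then show "w k \<in> nonneg_vecs"
      unfolding w_def using u(1) v(1) by (metis (full_types))
  qed
  moreover have "(\<Sum>k=1..r + s. rank_one (w k)) = A + B"
  proof -
    have "(\<Sum>k=1..r + s. rank_one (w k))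
        = (\<Sum>k=1..r. rank_one (w k)) + (\<Sum>k=r + 1..r + s. rank_one (w k) :: ('m, 'n) tensor)"
      by (rule sum.ub_add_nat) simp
    also have "(\<Sum>k=r + 1..r + s. rank_one (w k)) = (\<Sum>k=1..s. rank_one (w (k + r)) :: ('m, 'n) tensor)"
      using sum.shift_bounds_cl_nat_ivl [of "\<lambda>k. rank_one (w k)" 1 r s] by (simp add: add.commute)
    also have "\<dots> = B"
      unfolding v(2) by (intro sum.cong) (auto simp: w_def)
    also have "(\<Sum>k=1..r. rank_one (w k)) = A"
      unfolding u(2) by (intro sum.cong) (auto simp: w_def)
    finally show ?thesis .
  qed
  ultimately show ?thesis
    unfolding CP_def mem_Collect_eq by (intro exI [of _ "r + s"] exI [of _ w] conjI) simp_all
qed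

text \<open>A factor \<open>c \<ge> 0\<close> is absorbed into the generating vectors, as its \<open>m\<close>th root.\<close>

lemma CP_scaleR:
  assumes "A \<in> CP" "0 \<le> c"
  shows "c *\<^sub>R A \<in> (CP :: ('m::finite, 'n::finite) tensor set)"
proof -
  obtain r u where u: "\<forall>k\<in>{1..r}. u k \<in> nonneg_vecs" "A = (\<Sum>k=(1::nat)..r. rank_one (u k))"
    using assms by (auto simp: CP_def)
  define t where "t = root CARD('m) c"
  have t: "0 \<le> t" "t ^ CARD('m) = c"
    using assms(2) by (simp_all add: t_def)
  have "c *\<^sub>R A = (\<Sum>k=1..r. rank_one (t *\<^sub>R u k))"
    by (simp add: u(2) rank_one_scaleR t(2) scaleR_sum_right)
  moreover have "\<forall>k\<in>{1..r}. t *\<^sub>R u k \<in> nonneg_vecs"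
    using u(1) t(1) by (auto simp: nonneg_vecs_def)
  ultimately show ?thesis
    unfolding CP_def mem_Collect_eq
    by (intro exI [of _ r] exI [of _ "\<lambda>k. t *\<^sub>R u k"] conjI)
qed

lemma convex_cone_CP: "convex_cone CP"
  using CP_zero CP_add CP_scaleR by (auto simp: convex_cone_iff)

section \<open>Closedness of the completely positive cone\<close>

text \<open>The constant \<open>1\<close> in the definition below is the all-ones vector, so \<open>1 \<bullet> x\<close> is the
  coordinate sum.\<close>

definition prob_simplex :: "(real ^ 'n::finite) set" where
  "prob_simplex = {x \<in> nonneg_vecs. 1 \<bullet> x = 1}"

lemma one_inner_vec: "(1 :: real ^ 'n::finite) \<bullet> x = (\<Sum>j\<in>UNIV. x $ j)"
  by (simp add: inner_vec_def)

lemma compact_prob_simplex: "compact (prob_simplex :: (real ^ 'n::finite) set)"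
proof -
  have "closed (prob_simplex :: (real ^ 'n) set)"
  proof -
    have simplex: "prob_simplex = (\<Inter>j. {x :: real ^ 'n. 0 \<le> x $ j}) \<inter> {x. 1 \<bullet> x = 1}"
      by (auto simp: prob_simplex_def nonneg_vecs_def)
    have halfspace: "closed {x :: real ^ 'n. 0 \<le> x $ j}" for j
      by (intro closed_Collect_le continuous_intros)
    show ?thesis
      unfolding simplex by (intro closed_Int closed_INT closed_hyperplane ballI halfspace)
  qed
  moreover have "bounded (prob_simplex :: (real ^ 'n) set)"
  proof (rule boundedI)
    fix x :: "real ^ 'n" assume "x \<in> prob_simplex"
    then show "norm x \<le> 1"
      using norm_le_l1_cart [of x] by (simp add: prob_simplex_def nonneg_vecs_def one_inner_vec)
  qed
  ultimately show ?thesis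
    by (simp add: compact_eq_bounded_closed)
qed

lemma axis_in_prob_simplex: "axis j 1 \<in> prob_simplex"
  by (simp add: prob_simplex_def nonneg_vecs_def axis_def one_inner_vec)

lemma nonneg_vec_eq_scaled_prob:
  fixes x :: "real ^ 'n::finite"
  assumes "x \<in> nonneg_vecs"
  obtains c u where "0 \<le> c" "u \<in> prob_simplex" "x = c *\<^sub>R u"
proof (cases "1 \<bullet> x = 0")
  case True
  then have "x = 0"
    using assms by (simp add: one_inner_vec nonneg_vecs_def sum_nonneg_eq_0_iff vec_eq_iff)
  then show thesis
    using that [of 0] axis_in_prob_simplex by auto
next
  case False
  have "0 \<le> 1 \<bullet> x"
    using assms by (simp add: one_inner_vec nonneg_vecs_def sum_nonneg)
  with False assms have "(1 / (1 \<bullet> x)) *\<^sub>R x \<in> prob_simplex"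
    by (simp add: prob_simplex_def nonneg_vecs_def)
  with False \<open>0 \<le> 1 \<bullet> x\<close> show thesis
    by (intro that [of "1 \<bullet> x" "(1 / (1 \<bullet> x)) *\<^sub>R x"]) auto
qed

text \<open>This exhibits \<open>CP\<close> with generators from a compact set: homogeneity of the rank-one map
  turns the normalisation of a nonnegative vector into a nonnegative scalar factor of the tensor.\<close>

lemma CP_eq_convex_cone_hull:
  "(CP :: ('m::finite, 'n::finite) tensor set) = convex_cone hull (rank_one ` prob_simplex)"
  (is "_ = ?C")
proof
  have gen: "rank_one x \<in> ?C" if x: "x \<in> nonneg_vecs" for x
  proof -
    obtain c u where cu: "0 \<le> c" "u \<in> prob_simplex" "x = c *\<^sub>R u"
      using nonneg_vec_eq_scaled_prob [OF x] by blast
    have "rank_one u \<in> ?C"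
      using cu(2) by (intro hull_inc) auto
    then show ?thesis
      using cu by (simp add: rank_one_scaleR convex_cone_hull_mul)
  qed
  show "CP \<subseteq> ?C"
  proof
    fix A :: "('m, 'n) tensor" assume "A \<in> CP"
    then obtain r u where u: "\<forall>k\<in>{1..r}. u k \<in> nonneg_vecs" "A = (\<Sum>k=(1::nat)..r. rank_one (u k))"
      by (auto simp: CP_def)
    have "(\<Sum>k\<in>K. rank_one (u k)) \<in> ?C" if "K \<subseteq> {1..r}" for K
      using finite_subset [OF that finite_atLeastAtMost] that
    proof (induction rule: finite_induct)
      case empty
      show ?case by (simp add: convex_cone_hull_contains_0)
    next
      case (insert k K)
      then show ?case using u(1) gen by (auto intro!: convex_cone_hull_add)
    qed
    then show "A \<in> ?C" using u(2) by simp
  qed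
  show "?C \<subseteq> CP"
    using convex_cone_CP by (intro hull_minimal) (auto simp: prob_simplex_def intro: rank_one_in_CP)
qed

text \<open>A cone over a compact convex set is closed as long as the set avoids the origin. Here the sum of all
  entries, which is the pairing with the all-ones tensor \<open>rank_one 1\<close>, equals \<open>1\<close>
  on every generator and hence on the whole convex hull.\<close>

lemma closed_CP: "closed (CP :: ('m::finite, 'n::finite) tensor set)"
proof -
  let ?R = "rank_one ` prob_simplex :: ('m, 'n) tensor set"
  have "compact (convex hull ?R)"
    by (intro compact_convex_hull compact_continuous_image continuous_on_rank_one
        compact_prob_simplex)
  moreover have "convex hull ?R \<subseteq> {A. rank_one 1 \<bullet> A = 1}"
    by (rule hull_minimal)
      (auto simp: rank_one_inner_rank_one prob_simplex_def convex_hyperplane)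
  then have "0 \<notin> convex hull ?R"
    by auto
  moreover have "?R \<noteq> {}"
    using axis_in_prob_simplex by blast
  ultimately show ?thesis
    by (simp add: CP_eq_convex_cone_hull convex_cone_hull_separate_nonempty closed_conic_hull)
qed

section \<open>Duality\<close>

lemma COP_eq_dual_cone_CP: "COP = dual_cone CP"
proof -
  have "(\<forall>A\<in>CP. 0 \<le> A \<bullet> B) \<longleftrightarrow> (\<forall>x\<in>nonneg_vecs. 0 \<le> tensor_form B x)"
    for B :: "('a, 'b) tensor"
  proof
    assume "\<forall>A\<in>CP. 0 \<le> A \<bullet> B"
    then show "\<forall>x\<in>nonneg_vecs. 0 \<le> tensor_form B x"
      using rank_one_in_CP by (metis inner_commute inner_rank_one)
  next
    assume "\<forall>x\<in>nonneg_vecs. 0 \<le> tensor_form B x"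
    then show "\<forall>A\<in>CP. 0 \<le> A \<bullet> B"
      by (auto simp: CP_def inner_commute [of _ B] inner_sum_right inner_rank_one intro!: sum_nonneg)
  qed
  then show ?thesis
    by (auto simp: COP_def dual_cone_def)
qed

text \<open>The residual of the metric projection onto a closed convex cone separates: moving from \<open>p\<close>
  to \<open>p + y\<close> or to \<open>0\<close> stays in the cone, and neither move brings the point
  closer to \<open>a\<close>.\<close>

lemma closest_point_convex_cone:
  fixes a :: "'a::euclidean_space"
  assumes "convex_cone K" "closed K" "a \<notin> K"
  defines "p \<equiv> closest_point K a"
  shows "p \<in> K" and "\<And>y. y \<in> K \<Longrightarrow> 0 \<le> y \<bullet> (p - a)" and "a \<bullet> (p - a) < 0"
proof -
  have "convex K" "K \<noteq> {}" "0 \<in> K"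
    using assms(1) convex_cone_contains_0 by (auto simp: convex_cone_def)
  show pK: "p \<in> K"
    unfolding p_def using assms(2) \<open>K \<noteq> {}\<close> by (rule closest_point_in_set)
  have obtuse: "(a - p) \<bullet> (y - p) \<le> 0" if "y \<in> K" for y
    unfolding p_def using \<open>convex K\<close> assms(2) that by (rule closest_point_dot)
  show "0 \<le> y \<bullet> (p - a)" if "y \<in> K" for y
    using obtuse [of "p + y"] convex_cone_add [OF assms(1) pK that]
    by (simp add: inner_diff_left inner_diff_right inner_commute)
  have "p \<bullet> (p - a) \<le> 0"
    using obtuse [OF \<open>0 \<in> K\<close>] by (simp add: inner_diff_left inner_diff_right inner_commute)
  moreover have "0 < (p - a) \<bullet> (p - a)"
    using pK assms(3) by auto
  ultimately show "a \<bullet> (p - a) < 0"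
    by (simp add: inner_diff_left)
qed

text \<open>The bipolar theorem relative to the symmetric tensors. The separating tensor is the projection
  residual because that one is automatically symmetric.\<close>

lemma dual_cone_dual_cone:
  fixes K :: "('m::finite, 'n::finite) tensor set"
  assumes "convex_cone K" "closed K" and sym: "\<And>A. A \<in> K \<Longrightarrow> symmetric_tensor A"
  shows "dual_cone (dual_cone K) = K"
proof
  show "K \<subseteq> dual_cone (dual_cone K)"
    using sym by (auto simp: dual_cone_def inner_commute)
  show "dual_cone (dual_cone K) \<subseteq> K"
  proof
    fix A assume A: "A \<in> dual_cone (dual_cone K)"
    show "A \<in> K"
    proof (rule ccontr)
      assume "A \<notin> K"
      define P where "P = closest_point K A"
      note P = closest_point_convex_cone [OF assms(1,2) \<open>A \<notin> K\<close>, folded P_def]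
      have "symmetric_tensor (P - A)"
        using sym [OF P(1)] A by (auto simp: dual_cone_def intro: symmetric_tensor_diff)
      then have "P - A \<in> dual_cone K"
        using P(2) by (auto simp: dual_cone_def)
      then have "0 \<le> A \<bullet> (P - A)"
        using A by (auto simp: dual_cone_def inner_commute)
      with P(3) show False by simp
    qed
  qed
qed

theorem theorem5:
  assumes "CARD('m::finite) \<ge> 2"
  shows "(COP :: ('m, 'n::finite) tensor set) = dual_cone CP
       \<and> (CP :: ('m, 'n) tensor set) = dual_cone COP"
  using dual_cone_dual_cone [OF convex_cone_CP closed_CP CP_symmetric, where 'm = 'm and 'n = 'n]
  by (simp add: COP_eq_dual_cone_CP)

end
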